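(* The two compactifications $\alpha:\mathrm{SE}_3(\mathbb{R})\hookrightarrow \mathrm{Bl}_E(S)$ and $\beta:\mathrm{SE}_3(\mathbb{R})\hookrightarrow\mathbb{P}^3(\mathbb{R})\times\mathbb{P}^3(\mathbb{R})$ of $\mathrm{SE}_3(\mathbb{R})$ are isomorphic. More precisely, the morphism $\sigma:\mathbb{P}^3(\mathbb{R})\times\mathbb{P}^3(\mathbb{R})\to\mathbb{P}^7(\mathbb{R})\times\mathbb{P}^3(\mathbb{R})$, $([\underline{w}],[r,s,t,u])\mapsto([\underline{x},\underline{y}],[\underline{w}])$, defined by $$\begin{aligned} x_0&=w_0r, & 2y_0&=-w_1s-w_2t-w_3u,\\ x_1&=w_1r, & 2y_1&=w_0s+w_3t-w_2u,\\ x_2&=w_2r, & 2y_2&=-w_3s+w_0t+w_1u,\\ x_3&=w_3r, & 2y_3&=w_2s-w_1t+w_0u, \end{aligned}$$ induces a biregular isomorphism of real algebraic varieties $\sigma:\mathbb{P}^3(\mathbb{R})\times\mathbb{P}^3(\mathbb{R})\to\mathrm{Bl}_E(S)$ such that $\alpha=\sigma\circ\beta$.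
   Context: Notation: $\underline{x}=(x_0,\dots,x_3)$, $\underline{y}=(y_0,\dots,y_3)$, $\underline{w}=(w_0,\dots,w_3)$. Real varieties are understood as sets of real points, and regular maps (hence biregular isomorphisms) are in the sense of Bochnak–Coste–Roy, Real Algebraic Geometry: maps given locally (in affine charts) by quotients of real polynomials whose denominators have no zeros on the relevant set of real points; a biregular isomorphism is a bijective regular map with regular inverse. $\mathrm{SE}_3(\mathbb{R})$ is the group of rigid motions $\mathbf{v}\mapsto \mathbf{R}\mathbf{v}+\mathbf{t}$ of $\mathbb{R}^3$, with $\mathbf{R}\in\mathrm{SO}_3(\mathbb{R})$, $\mathbf{t}\in\mathbb{R}^3$. Put $\Delta(\underline{x})=\sum_{i=0}^3x_i^2$, $$\mathbf{R}(\underline{x})=\begin{bmatrix} x_0^2 + x_1^2 - x_2^2 - x_3^2 & 2(x_1x_2 - x_0x_3) & 2(x_1x_3 + x_0x_2)\\ 2(x_1x_2 + x_0x_3) & x_0^2 - x_1^2 + x_2^2 - x_3^2 & 2(x_2x_3 - x_0x_1)\\ 2(x_1x_3 - x_0x_2) & 2(x_2x_3 + x_0x_1) & x_0^2 - x_1^2 - x_2^2 + x_3^2 \end{bmatrix},$$ $$\mathbf{t}(\underline{x},\underline{y})=2\begin{bmatrix} x_0y_1 - x_1y_0 + x_2y_3 - x_3y_2\\ x_0y_2 - x_1y_3 - x_2y_0 + x_3y_1\\ x_0y_3 + x_1y_2 - x_2y_1 - x_3y_0\end{bmatrix}.$$ Study model: $S\subset\mathbb{P}^7(\mathbb{R})$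 (homogeneous coordinates $[\underline{x},\underline{y}]$) is the Study quadric with equation $\sum_{i=0}^3x_iy_i=0$, and $E\subset S$ is the projective 3-plane $x_0=x_1=x_2=x_3=0$. By a classical theorem of Study, there is a one-to-one correspondence $S\setminus E\cong\mathrm{SE}_3(\mathbb{R})$ associating to $[\underline{x},\underline{y}]$ the rigid motion $\mathbf{v}\mapsto\frac{1}{\Delta(\underline{x})}\left(\mathbf{R}(\underline{x})\mathbf{v}+\mathbf{t}(\underline{x},\underline{y})\right)$. Compactification $\alpha$: the blowing-up of $S$ along $E$ is $$\mathrm{Bl}_E(S)=\Big\{([\underline{x},\underline{y}],[\underline{w}])\in\mathbb{P}^7(\mathbb{R})\times\mathbb{P}^3(\mathbb{R}) \ \Big|\ \sum_{i=0}^3x_iy_i=0,\ \sum_{i=0}^3y_iw_i=0,\ x_iw_j-x_jw_i=0 \text{ for } 0\le i<j\le 3\Big\},$$ with $\pi:\mathrm{Bl}_E(S)\to S$ the restriction of the first projection. The map $\pi$ restricts to an isomorphism $\mathrm{Bl}_E(S)\setminus\pi^{-1}(E)\to S\setminus E$, and $\alpha$ is the composite $$\alpha:\mathrm{SE}_3(\mathbb{R})\cong S\setminus E\longrightarrow\mathrm{Bl}_E(S)\setminus\pi^{-1}(E)\hookrightarrow\mathrm{Bl}_E(S),$$ where the first identification is the Study correspondence and the second arrow is the inverse of that restriction of $\pi$. Compactification $\beta$: $\mathrm{SE}_3(\mathbb{R})\cong\mathrm{SO}_3(\mathbb{R})\ltimes\mathbb{R}^3$, the motion $\mathbf{v}\mapsto\mathbf{R}\mathbf{v}+\mathbf{t}$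 corresponding to $(\mathbf{R},\mathbf{t})$. The group $\mathrm{SO}_3(\mathbb{R})$ is identified with $\mathbb{P}^3(\mathbb{R})$ via the isomorphism of real varieties $\mathbb{P}^3(\mathbb{R})\to\mathrm{SO}_3(\mathbb{R})$, $[\underline{w}]\mapsto\frac{1}{\Delta(\underline{w})}\mathbf{R}(\underline{w})$, and $\mathbb{R}^3$ is embedded in $\mathbb{P}^3(\mathbb{R})$ (homogeneous coordinates $[r,s,t,u]$) by $(a,b,c)\mapsto[1,a,b,c]$. Then $\beta$ is the resulting embedding $\mathrm{SE}_3(\mathbb{R})\cong\mathrm{SO}_3(\mathbb{R})\ltimes\mathbb{R}^3\hookrightarrow\mathbb{P}^3(\mathbb{R})\times\mathbb{P}^3(\mathbb{R})$, with rotation part in the first factor and translation part in the second. *)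

theory Defs
  imports "HOL-Analysis.Analysis"
begin

section \<open>Real projective spaces and regular maps\<close>

quotient_type (overloaded) 'a proj =
    "'a::euclidean_space" / partial: "\<lambda>v w. v \<noteq> 0 \<and> w \<noteq> 0 \<and> (\<exists>c::real. c \<noteq> 0 \<and> v = c *\<^sub>R w)"
  morphisms rep_proj proj_of
proof (rule part_equivpI)
  obtain b :: 'a where "b \<in> Basis" using nonempty_Basis by blast
  then have "b \<noteq> 0" by (rule nonzero_Basis)
  then show "\<exists>v::'a. v \<noteq> 0 \<and> v \<noteq> 0 \<and> (\<exists>c::real. c \<noteq> 0 \<and> v = c *\<^sub>R v)"
    by (intro exI[of _ b] conjI exI[of _ "1::real"]) auto
next
  show "symp (\<lambda>v w::'a. v \<noteq> 0 \<and> w \<noteq> 0 \<and> (\<exists>c::real. c \<noteq> 0 \<and> v = c *\<^sub>R w))"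
  proof (rule sympI, elim conjE exE, intro conjI)
    fix v w :: 'a and c :: real
    assume "c \<noteq> 0" "v = c *\<^sub>R w"
    then show "\<exists>c::real. c \<noteq> 0 \<and> w = c *\<^sub>R v"
      by (intro exI[of _ "inverse c"]) simp
  qed
next
  show "transp (\<lambda>v w::'a. v \<noteq> 0 \<and> w \<noteq> 0 \<and> (\<exists>c::real. c \<noteq> 0 \<and> v = c *\<^sub>R w))"
  proof (rule transpI, elim conjE exE, intro conjI)
    fix u v w :: 'a and c d :: real
    assume "c \<noteq> 0" "d \<noteq> 0" "u = c *\<^sub>R v" "v = d *\<^sub>R w"
    then show "\<exists>c::real. c \<noteq> 0 \<and> u = c *\<^sub>R w"
      by (intro exI[of _ "c * d"]) simp
  qed
qed

lemma proj_of_eq_iff: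
  assumes "v \<noteq> 0" "w \<noteq> 0"
  shows "proj_of v = proj_of w \<longleftrightarrow> (\<exists>c::real. c \<noteq> 0 \<and> v = c *\<^sub>R w)"
proof -
  have refl: "\<exists>c::real. c \<noteq> 0 \<and> u = c *\<^sub>R u" for u :: 'a
    by (intro exI[of _ "1::real"]) simp
  show ?thesis
    using Quotient3_rel[OF Quotient3_proj, of v w] refl[of v] refl[of w] assms by blast
qed

lemma proj_of_cases:
  obtains v where "v \<noteq> 0" "p = proj_of v"
  using Quotient3_abs_rep[OF Quotient3_proj, of p] Quotient3_rep_reflp[OF Quotient3_proj, of p]
  by metis

text \<open>The standard affine chart of the projective space attached to a basis vector \<open>b\<close>,
  with domain \<open>{[v]. v \<bullet> b \<noteq> 0}\<close>.  Its values are the normalised representatives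
  \<open>v / (v \<bullet> b)\<close>, so affine space is realised as the hyperplane \<open>{u. u \<bullet> b = 1}\<close>; the
  coordinates of the value are the usual affine coordinates, together with the constant \<open>1\<close> at \<open>b\<close>.\<close>

lift_definition in_chart :: "'a::euclidean_space \<Rightarrow> 'a proj \<Rightarrow> bool"
  is "\<lambda>b v. v \<bullet> b \<noteq> 0"
  by auto

lift_definition affine_coords :: "'a::euclidean_space \<Rightarrow> 'a proj \<Rightarrow> 'a"
  is "\<lambda>b v. (1 / (v \<bullet> b)) *\<^sub>R v"
  by auto

definition chart_dom ::
    "'a::euclidean_space \<Rightarrow> 'b::euclidean_space \<Rightarrow> ('a proj \<times> 'b proj) set" where
  "chart_dom b c = {(p, q). in_chart b p \<and> in_chart c q}"

definition chart ::
    "'a::euclidean_space \<Rightarrow> 'b::euclidean_space \<Rightarrow> 'a proj \<times> 'b proj \<Rightarrow> 'a \<times> 'b" where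
  "chart b c = (\<lambda>(p, q). (affine_coords b p, affine_coords c q))"

text \<open>The set \<open>N\<close> is a basic Zariski-open neighbourhood of \<open>p\<close> in \<open>X\<close>, contained in one chart.
  The functions satisfying \<^const>\<open>real_polynomial_function\<close> on a Euclidean space are exactly
  the real polynomials in its coordinates.\<close>

definition regular_map ::
    "('a::euclidean_space proj \<times> 'b::euclidean_space proj) set \<Rightarrow>
     ('c::euclidean_space proj \<times> 'd::euclidean_space proj) set \<Rightarrow>
     ('a proj \<times> 'b proj \<Rightarrow> 'c proj \<times> 'd proj) \<Rightarrow> bool" where
  "regular_map X Y f \<longleftrightarrow>
     f ` X \<subseteq> Y \<and>
     (\<forall>p\<in>X. \<exists>b\<in>Basis. \<exists>c\<in>Basis. \<exists>d\<in>Basis. \<exists>e\<in>Basis. \<exists>D N.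
        real_polynomial_function D \<and>
        N = {x \<in> X \<inter> chart_dom b c. D (chart b c x) \<noteq> 0} \<and>
        p \<in> N \<and> f ` N \<subseteq> chart_dom d e \<and>
        (\<forall>k\<in>Basis. \<exists>P Q. real_polynomial_function P \<and> real_polynomial_function Q \<and>
           (\<forall>x\<in>N. Q (chart b c x) \<noteq> 0 \<and>
                  chart d e (f x) \<bullet> k = P (chart b c x) / Q (chart b c x))))"

definition biregular_iso ::
    "('a::euclidean_space proj \<times> 'b::euclidean_space proj) set \<Rightarrow>
     ('c::euclidean_space proj \<times> 'd::euclidean_space proj) set \<Rightarrow>
     ('a proj \<times> 'b proj \<Rightarrow> 'c proj \<times> 'd proj) \<Rightarrow> bool" where
  "biregular_iso X Y f \<longleftrightarrow>
     bij_betw f X Y \<and> regular_map X Y f \<and> regular_map Y X (inv_into X f)"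

section \<open>Rigid motions\<close>

definition SO3 :: "(real^3^3) set" where
  "SO3 = {R. rotation_matrix R}"

definition rigid_motion :: "real^3^3 \<Rightarrow> real^3 \<Rightarrow> real^3 \<Rightarrow> real^3" where
  "rigid_motion R t = (\<lambda>v. R *v v + t)"

definition SE3 :: "(real^3 \<Rightarrow> real^3) set" where
  "SE3 = {rigid_motion R t |R t. R \<in> SO3}"

text \<open>Vectors of type \<^typ>\<open>real^4\<close> are indexed by \<open>0, 1, 2, 3\<close>.  Beware that \<^const>\<open>vector\<close> counts
  from \<open>1\<close>, so that in dimension 4 its last entry would get the index \<open>4 = 0\<close>; hence the
  following constructor.  Vectors and matrices in dimension 3 are indexed by \<open>1, 2, 3\<close>.\<close>

definition vec4 :: "real \<Rightarrow> real \<Rightarrow> real \<Rightarrow> real \<Rightarrow> real^4" where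
  "vec4 a b c d = (\<chi> i. if i = 0 then a else if i = 1 then b else if i = 2 then c else d)"

definition Delta :: "real^4 \<Rightarrow> real" where
  "Delta x = (\<Sum>i\<in>UNIV. (x$i)\<^sup>2)"

definition rot_mat :: "real^4 \<Rightarrow> real^3^3" where
  "rot_mat x = vector [
     vector [(x$0)\<^sup>2 + (x$1)\<^sup>2 - (x$2)\<^sup>2 - (x$3)\<^sup>2, 2 * (x$1 * x$2 - x$0 * x$3), 2 * (x$1 * x$3 + x$0 * x$2)],
     vector [2 * (x$1 * x$2 + x$0 * x$3), (x$0)\<^sup>2 - (x$1)\<^sup>2 + (x$2)\<^sup>2 - (x$3)\<^sup>2, 2 * (x$2 * x$3 - x$0 * x$1)],
     vector [2 * (x$1 * x$3 - x$0 * x$2), 2 * (x$2 * x$3 + x$0 * x$1), (x$0)\<^sup>2 - (x$1)\<^sup>2 - (x$2)\<^sup>2 + (x$3)\<^sup>2]]"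

definition trans_vec :: "real^4 \<Rightarrow> real^4 \<Rightarrow> real^3" where
  "trans_vec x y = 2 *\<^sub>R vector [
     x$0 * y$1 - x$1 * y$0 + x$2 * y$3 - x$3 * y$2,
     x$0 * y$2 - x$1 * y$3 - x$2 * y$0 + x$3 * y$1,
     x$0 * y$3 + x$1 * y$2 - x$2 * y$1 - x$3 * y$0]"

lemma Delta_scaleR: "Delta (c *\<^sub>R x) = c\<^sup>2 * Delta x"
  by (simp add: Delta_def power_mult_distrib sum_distrib_left)

lemma rot_mat_scaleR: "rot_mat (c *\<^sub>R x) = c\<^sup>2 *\<^sub>R rot_mat x"
  by (simp add: rot_mat_def vec_eq_iff forall_3 power2_eq_square algebra_simps)

lemma trans_vec_scaleR: "trans_vec (c *\<^sub>R x) (c *\<^sub>R y) = c\<^sup>2 *\<^sub>R trans_vec x y"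
  by (simp add: trans_vec_def vec_eq_iff forall_3 power2_eq_square algebra_simps)

section \<open>The Study model and the blow-up\<close>

text \<open>The homogeneous coordinates of 7-dimensional projective space are grouped as pairs
  \<open>(x, y)\<close> of type \<^typ>\<open>(real^4) \<times> (real^4)\<close>.\<close>

definition study_quadric :: "((real^4) \<times> (real^4)) proj set" where
  "study_quadric = {proj_of (x, y) |x y. (x, y) \<noteq> 0 \<and> (\<Sum>i\<in>UNIV. x$i * y$i) = 0}"

definition exc_plane :: "((real^4) \<times> (real^4)) proj set" where
  "exc_plane = {proj_of (0, y) |y. y \<noteq> 0}"

lift_definition study_motion :: "((real^4) \<times> (real^4)) proj \<Rightarrow> real^3 \<Rightarrow> real^3"
  is "\<lambda>(x, y) v. (1 / Delta x) *\<^sub>R (rot_mat x *v v + trans_vec x y)"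
  by (auto simp: fun_eq_iff Delta_scaleR rot_mat_scaleR trans_vec_scaleR
      scaleR_matrix_vector_assoc[symmetric] scaleR_add_right[symmetric])

definition blowup :: "(((real^4) \<times> (real^4)) proj \<times> (real^4) proj) set" where
  "blowup = {(proj_of (x, y), proj_of w) |x y w.
     (x, y) \<noteq> 0 \<and> w \<noteq> 0 \<and>
     (\<Sum>i\<in>UNIV. x$i * y$i) = 0 \<and> (\<Sum>i\<in>UNIV. y$i * w$i) = 0 \<and>
     (\<forall>i j. x$i * w$j - x$j * w$i = 0)}"

text \<open>Both restrictions inverted below are bijections onto their targets: the second one is the
  Study correspondence between \<open>S - E\<close> and \<open>SE3\<close>, the first one is the projection of the
  blow-up away from its exceptional divisor.\<close>

definition alpha :: "(real^3 \<Rightarrow> real^3) \<Rightarrow> ((real^4) \<times> (real^4)) proj \<times> (real^4) proj" where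
  "alpha g =
     inv_into (blowup - fst -` exc_plane) fst
       (inv_into (study_quadric - exc_plane) study_motion g)"

section \<open>The compactification by a product of projective spaces\<close>

lift_definition proj_rotation :: "(real^4) proj \<Rightarrow> real^3^3"
  is "\<lambda>w. (1 / Delta w) *\<^sub>R rot_mat w"
  by (auto simp: Delta_scaleR rot_mat_scaleR)

definition embed_R3 :: "real^3 \<Rightarrow> (real^4) proj" where
  "embed_R3 v = proj_of (vec4 1 (v$1) (v$2) (v$3))"

text \<open>Rotation part in the first factor, identified with a point of projective 3-space through the
  bijection \<^const>\<open>proj_rotation\<close> onto \<^const>\<open>SO3\<close>; translation part in the second.\<close>

definition beta :: "(real^3 \<Rightarrow> real^3) \<Rightarrow> (real^4) proj \<times> (real^4) proj" where
  "beta g =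
     (let (R, t) = inv_into (SO3 \<times> UNIV) (\<lambda>(R, t). rigid_motion R t) g
      in (inv_into UNIV proj_rotation R, embed_R3 t))"

section \<open>The morphism between the two compactifications\<close>

definition sigma_x :: "real^4 \<Rightarrow> real^4 \<Rightarrow> real^4" where
  "sigma_x w z = (let r = z$0 in vec4 (w$0 * r) (w$1 * r) (w$2 * r) (w$3 * r))"

definition sigma_y :: "real^4 \<Rightarrow> real^4 \<Rightarrow> real^4" where
  "sigma_y w z = (let s = z$1; t = z$2; u = z$3 in (1/2) *\<^sub>R vec4
     (- w$1 * s - w$2 * t - w$3 * u)
     (w$0 * s + w$3 * t - w$2 * u)
     (- w$3 * s + w$0 * t + w$1 * u)
     (w$2 * s - w$1 * t + w$0 * u))"

lemma UNIV_4_from_0: "(UNIV :: 4 set) = {0, 1, 2, 3}"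
proof -
  have "(4::4) = 0" by simp
  then show ?thesis unfolding UNIV_4 by auto
qed

lemma forall_4_from_0: "(\<forall>i::4. P i) \<longleftrightarrow> P 0 \<and> P 1 \<and> P 2 \<and> P 3"
proof -
  have "(\<forall>i::4. P i) \<longleftrightarrow> (\<forall>i\<in>{0, 1, 2, 3}. P i)"
    using UNIV_4_from_0 by (metis UNIV_I)
  then show ?thesis by simp
qed

lemma vec4_nth [simp]:
  "vec4 a b c d $ 0 = a" "vec4 a b c d $ 1 = b" "vec4 a b c d $ 2 = c" "vec4 a b c d $ 3 = d"
  by (simp_all add: vec4_def)

lemma sigma_scaleR:
  "sigma_x (a *\<^sub>R w) (b *\<^sub>R z) = (a * b) *\<^sub>R sigma_x w z"
  "sigma_y (a *\<^sub>R w) (b *\<^sub>R z) = (a * b) *\<^sub>R sigma_y w z"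
  by (simp_all add: sigma_x_def sigma_y_def Let_def vec_eq_iff forall_4_from_0 algebra_simps)

lemma sigma_nonzero:
  assumes "w \<noteq> 0" "z \<noteq> 0"
  shows "(sigma_x w z, sigma_y w z) \<noteq> 0"
proof
  assume "(sigma_x w z, sigma_y w z) = 0"
  then have x: "w$0 * z$0 = 0" "w$1 * z$0 = 0" "w$2 * z$0 = 0" "w$3 * z$0 = 0"
    and y: "- w$1 * z$1 - w$2 * z$2 - w$3 * z$3 = 0"
      "w$0 * z$1 + w$3 * z$2 - w$2 * z$3 = 0"
      "- w$3 * z$1 + w$0 * z$2 + w$1 * z$3 = 0"
      "w$2 * z$1 - w$1 * z$2 + w$0 * z$3 = 0"
    by (simp_all add: zero_prod_def sigma_x_def sigma_y_def Let_def vec_eq_iff forall_4_from_0)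
  define n where "n = (w$0)\<^sup>2 + (w$1)\<^sup>2 + (w$2)\<^sup>2 + (w$3)\<^sup>2"
  have "n \<noteq> 0"
  proof
    assume "n = 0"
    then have "w$0 = 0 \<and> w$1 = 0 \<and> w$2 = 0 \<and> w$3 = 0"
      unfolding n_def by (smt (verit) zero_le_power2 power2_less_eq_zero_iff)
    then show False using assms(1) by (simp add: vec_eq_iff forall_4_from_0)
  qed
  moreover have "n * z$0 = 0" using x unfolding n_def by algebra
  moreover have "n * z$1 = 0" using y unfolding n_def by algebra
  moreover have "n * z$2 = 0" using y unfolding n_def by algebra
  moreover have "n * z$3 = 0" using y unfolding n_def by algebra
  ultimately show False using assms(2) by (simp add: vec_eq_iff forall_4_from_0)
qed

lift_definition sigma_map ::
    "(real^4) proj \<times> (real^4) proj \<Rightarrow> ((real^4) \<times> (real^4)) proj \<times> (real^4) proj"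
  is "\<lambda>(w, z). ((sigma_x w z, sigma_y w z), w)"
proof -
  fix p q :: "(real^4) \<times> (real^4)"
  assume "rel_prod (\<lambda>v w. v \<noteq> 0 \<and> w \<noteq> 0 \<and> (\<exists>c::real. c \<noteq> 0 \<and> v = c *\<^sub>R w))
      (\<lambda>v w. v \<noteq> 0 \<and> w \<noteq> 0 \<and> (\<exists>c::real. c \<noteq> 0 \<and> v = c *\<^sub>R w)) p q"
  then obtain w z a b where "w \<noteq> 0" "z \<noteq> 0" "a \<noteq> 0" "b \<noteq> 0"
      "p = (a *\<^sub>R w, b *\<^sub>R z)" "q = (w, z)"
    by (cases p; cases q) auto
  then show "?thesis p q"
    using sigma_nonzero[of w z] sigma_nonzero[of "a *\<^sub>R w" "b *\<^sub>R z"]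
    by (auto simp: sigma_scaleR intro!: exI[of _ "a * b"])
qed

lemma sigma_map_proj_of:
  assumes "w \<noteq> 0" "z \<noteq> 0"
  shows "sigma_map (proj_of w, proj_of z) = (proj_of (sigma_x w z, sigma_y w z), proj_of w)"
proof -
  have "\<exists>c::real. c \<noteq> 0 \<and> u = c *\<^sub>R u" for u :: "real^4"
    by (intro exI[of _ "1::real"]) simp
  then show ?thesis
    using sigma_map.abs_eq[of "(w, z)"] assms by simp
qed

end

theory Submission imports Defs begin

text \<open>
  In quaternion notation, the map \<open>sigma\<close> multiplies the quaternion \<open>w\<close> by the coordinates \<open>[r, s, t, u]\<close>:
  the product with the scalar part \<open>r\<close> gives \<open>x\<close>, and the product of the pure quaternion with
  components \<open>s, t, u\<close> and \<open>w\<close> gives \<open>2 y\<close>.  Multiplication by the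
  conjugate of \<open>w\<close> undoes this up to the norm \<open>Delta w\<close>, so \<open>sigma\<close> is inverted by a bilinear formula as well: for \<open>([x, y], [w])\<close> the vector
  \<open>[w \<bullet> x, trans_vec w y]\<close> is the only possible value of \<open>[r, s, t, u]\<close>.  Both composites of the two
  formulas are multiplication by \<open>Delta w\<close> (lemmas \<open>inverse_coords_sigma\<close> and \<open>sigma_inverse_coords\<close>),
  one of them identically and the other one on the blow-up, where \<open>x\<close> is proportional to \<open>w\<close> and \<open>y\<close> is
  orthogonal to \<open>w\<close>.  As \<open>Delta w\<close> has no real zeros besides \<open>w = 0\<close>, this makes \<open>sigma\<close> a bijection
  onto the blow-up.  Both directions are given by polynomials in the homogeneous coordinates that
  never vanish simultaneously at a real point of the source, and every such map is regular (lemma \<open>regular_map_polynomial\<close>).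

  For the identity \<open>alpha = sigma \<circ> beta\<close>, substituting \<open>r = 1\<close> shows that the first component of
  \<open>sigma\<close> sends a rotation \<open>[w]\<close> and a translation vector \<open>t\<close> to the point of the Study quadric
  that represents the motion with rotation \<open>[w]\<close> and translation \<open>t\<close>
  (lemma \<open>study_motion_sigma\<close>).  Since \<open>alpha\<close> and \<open>beta\<close> are
  built from inverse functions, it remains to see that the functions being inverted are
  injective and reach the motion in question.  The essential case is the parametrisation of rotations by
  projective 3-space.  A rotation matrix determines, by linear formulas, a symmetric \<open>4 \<times> 4\<close> matrix which
  for the rotation of \<open>w\<close> has entries proportional to \<open>w\<^sub>i w\<^sub>j\<close>; this gives injectivity.  For an arbitrary rotation
  the orthogonality and cofactor relations force this matrix to have rank one
  (lemma \<open>quat_products_rank_one\<close>), and any of its nonzero rows is a quaternion for the rotation.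
\<close>

section \<open>Points and charts of projective space\<close>

text \<open>The equations that the lifting of definitions to the quotient provides carry reflexivity of the
  underlying partial equivalence as a premise.\<close>

lemma proj_rel_refl:
  fixes v :: "'a::euclidean_space"
  assumes "v \<noteq> 0"
  shows "v \<noteq> 0 \<and> v \<noteq> 0 \<and> (\<exists>c::real. c \<noteq> 0 \<and> v = c *\<^sub>R v)"
  using assms by (auto intro!: exI[of _ "1::real"])

lemma in_chart_proj_of:
  assumes "v \<noteq> 0"
  shows "in_chart b (proj_of v) \<longleftrightarrow> v \<bullet> b \<noteq> 0"
  using proj_rel_refl[OF assms] by (rule in_chart.abs_eq)

lemma affine_coords_proj_of:
  assumes "v \<noteq> 0"
  shows "affine_coords b (proj_of v) = (1 / (v \<bullet> b)) *\<^sub>R v"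
  using proj_rel_refl[OF assms] by (rule affine_coords.abs_eq)

lemma proj_rotation_proj_of:
  assumes "w \<noteq> 0"
  shows "proj_rotation (proj_of w) = (1 / Delta w) *\<^sub>R rot_mat w"
  using proj_rel_refl[OF assms] by (rule proj_rotation.abs_eq)

lemma study_motion_proj_of:
  assumes "(x, y) \<noteq> 0"
  shows "study_motion (proj_of (x, y)) v = (1 / Delta x) *\<^sub>R (rot_mat x *v v + trans_vec x y)"
  using study_motion.abs_eq[OF proj_rel_refl[OF assms]] by simp

lemma proj_of_scaleR:
  assumes "c \<noteq> 0" "v \<noteq> 0"
  shows "proj_of (c *\<^sub>R v) = proj_of v"
proof -
  have "c *\<^sub>R v \<noteq> 0" using assms by simp
  then show ?thesis using assms proj_of_eq_iff by blast
qed

lemma proj_of_affine_coords: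
  assumes "in_chart b p"
  shows "affine_coords b p \<noteq> 0" and "proj_of (affine_coords b p) = p"
proof -
  obtain v where v: "v \<noteq> 0" "p = proj_of v" by (rule proj_of_cases)
  then have b: "v \<bullet> b \<noteq> 0" using assms by (simp add: in_chart_proj_of)
  then show nz: "affine_coords b p \<noteq> 0" using v by (simp add: affine_coords_proj_of)
  have "\<exists>c::real. c \<noteq> 0 \<and> affine_coords b p = c *\<^sub>R v"
    using v b by (auto simp: affine_coords_proj_of intro!: exI[of _ "1 / (v \<bullet> b)"])
  then show "proj_of (affine_coords b p) = p"
    using proj_of_eq_iff[OF nz v(1)] v(2) by simp
qed

section \<open>Maps given by polynomials are regular\<close>

lemma Basis_inner_nonzero:
  fixes v :: "'a::euclidean_space"
  assumes "v \<noteq> 0"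
  obtains b where "b \<in> Basis" "v \<bullet> b \<noteq> 0"
  using assms euclidean_all_zero_iff by blast

text \<open>The quotients required by the definition of regularity come from dividing by the
  coordinates of \<open>F\<close> and \<open>G\<close> that define the target chart.  On the source side the chart values
  are themselves representatives of the point, so \<open>F\<close> and \<open>G\<close> may be evaluated at them directly.\<close>

lemma regular_map_polynomial:
  fixes f :: "'a::euclidean_space proj \<times> 'b::euclidean_space proj \<Rightarrow> 'c::euclidean_space proj \<times> 'd::euclidean_space proj"
    and F :: "'a \<times> 'b \<Rightarrow> 'c" and G :: "'a \<times> 'b \<Rightarrow> 'd"
  assumes F: "polynomial_function F" and G: "polynomial_function G"
    and nonzero: "\<And>u v. u \<noteq> 0 \<Longrightarrow> v \<noteq> 0 \<Longrightarrow> (proj_of u, proj_of v) \<in> X \<Longrightarrow> F (u, v) \<noteq> 0 \<and> G (u, v) \<noteq> 0"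
    and f: "\<And>u v. u \<noteq> 0 \<Longrightarrow> v \<noteq> 0 \<Longrightarrow> (proj_of u, proj_of v) \<in> X \<Longrightarrow>
              f (proj_of u, proj_of v) = (proj_of (F (u, v)), proj_of (G (u, v)))"
    and image: "f ` X \<subseteq> Y"
  shows "regular_map X Y f"
  unfolding regular_map_def
proof (intro conjI ballI image)
  fix p assume p: "p \<in> X"
  have rep: "F (chart b c x) \<noteq> 0" "G (chart b c x) \<noteq> 0"
      "f x = (proj_of (F (chart b c x)), proj_of (G (chart b c x)))"
    if "x \<in> X \<inter> chart_dom b c" for x b c
  proof -
    obtain q r where x: "x = (q, r)" by (cases x)
    with that have "in_chart b q" "in_chart c r" by (auto simp: chart_dom_def)
    note q = proj_of_affine_coords[OF this(1)] and r = proj_of_affine_coords[OF this(2)]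
    have "(proj_of (affine_coords b q), proj_of (affine_coords c r)) \<in> X"
      using that x q r by simp
    from nonzero[OF q(1) r(1) this] f[OF q(1) r(1) this]
    show "F (chart b c x) \<noteq> 0" "G (chart b c x) \<noteq> 0"
      "f x = (proj_of (F (chart b c x)), proj_of (G (chart b c x)))"
      by (simp_all add: x chart_def q r)
  qed
  obtain u v where uv: "u \<noteq> 0" "v \<noteq> 0" "p = (proj_of u, proj_of v)"
    by (metis proj_of_cases surj_pair)
  obtain b where b: "b \<in> Basis" "u \<bullet> b \<noteq> 0" using uv(1) by (rule Basis_inner_nonzero)
  obtain c where c: "c \<in> Basis" "v \<bullet> c \<noteq> 0" using uv(2) by (rule Basis_inner_nonzero)
  have p_dom: "p \<in> X \<inter> chart_dom b c"
    using p uv b c by (simp add: chart_dom_def in_chart_proj_of)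
  obtain d where d: "d \<in> Basis" "F (chart b c p) \<bullet> d \<noteq> 0"
    using rep(1)[OF p_dom] by (rule Basis_inner_nonzero)
  obtain e where e: "e \<in> Basis" "G (chart b c p) \<bullet> e \<noteq> 0"
    using rep(2)[OF p_dom] by (rule Basis_inner_nonzero)
  have coord: "real_polynomial_function (\<lambda>x. F x \<bullet> k)" "real_polynomial_function (\<lambda>x. G x \<bullet> l)"
    for k l
    using F G polynomial_function_inner by (auto simp: real_polynomial_function_eq)
  \<comment> \<open>Where \<open>D\<close> is nonzero, both target charts are defined at once.\<close>
  define D where "D = (\<lambda>x. (F x \<bullet> d) * (G x \<bullet> e))"
  define N where "N = {x \<in> X \<inter> chart_dom b c. D (chart b c x) \<noteq> 0}"
  have D: "real_polynomial_function D"
    unfolding D_def by (intro real_polynomial_function.intros(4) coord)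
  have N: "F (chart b c x) \<bullet> d \<noteq> 0" "G (chart b c x) \<bullet> e \<noteq> 0" "f x \<in> chart_dom d e"
      "chart d e (f x) = ((1 / (F (chart b c x) \<bullet> d)) *\<^sub>R F (chart b c x),
                          (1 / (G (chart b c x) \<bullet> e)) *\<^sub>R G (chart b c x))"
    if "x \<in> N" for x
    using that rep[of x b c]
    by (auto simp: N_def D_def chart_dom_def chart_def in_chart_proj_of affine_coords_proj_of)
  have quot: "\<exists>P Q. real_polynomial_function P \<and> real_polynomial_function Q \<and>
           (\<forall>x\<in>N. Q (chart b c x) \<noteq> 0 \<and> chart d e (f x) \<bullet> k = P (chart b c x) / Q (chart b c x))"
    if "k \<in> Basis" for k :: "'c \<times> 'd"
    using that unfolding Basis_prod_def
  proof (elim UnE imageE)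
    fix k' assume "k = (k', 0)"
    then show ?thesis
      using N by (intro exI[of _ "\<lambda>x. F x \<bullet> k'"] exI[of _ "\<lambda>x. F x \<bullet> d"]) (simp add: coord)
  next
    fix k' assume "k = (0, k')"
    then show ?thesis
      using N by (intro exI[of _ "\<lambda>x. G x \<bullet> k'"] exI[of _ "\<lambda>x. G x \<bullet> e"]) (simp add: coord)
  qed
  have "p \<in> N" using p_dom d(2) e(2) by (simp add: N_def D_def)
  then show "\<exists>b\<in>Basis. \<exists>c\<in>Basis. \<exists>d\<in>Basis. \<exists>e\<in>Basis. \<exists>D N.
        real_polynomial_function D \<and>
        N = {x \<in> X \<inter> chart_dom b c. D (chart b c x) \<noteq> 0} \<and>
        p \<in> N \<and> f ` N \<subseteq> chart_dom d e \<and>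
        (\<forall>k\<in>Basis. \<exists>P Q. real_polynomial_function P \<and> real_polynomial_function Q \<and>
           (\<forall>x\<in>N. Q (chart b c x) \<noteq> 0 \<and>
                  chart d e (f x) \<bullet> k = P (chart b c x) / Q (chart b c x)))"
    using b(1) c(1) d(1) e(1) D N_def N(3) quot
    by (intro bexI[of _ b] bexI[of _ c] bexI[of _ d] bexI[of _ e] exI[of _ D] exI[of _ N]) auto
qed

lemma polynomial_function_Pair:
  fixes f :: "'a::real_normed_vector \<Rightarrow> 'b::euclidean_space" and g :: "'a \<Rightarrow> 'c::euclidean_space"
  assumes "polynomial_function f" "polynomial_function g"
  shows "polynomial_function (\<lambda>x. (f x, g x))"
  using assms by (auto simp: polynomial_function_iff_Basis_inner Basis_prod_def)

lemma polynomial_function_vec: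
  fixes f :: "'a::real_normed_vector \<Rightarrow> real^'n"
  assumes "\<And>i. real_polynomial_function (\<lambda>x. f x $ i)"
  shows "polynomial_function f"
  using assms by (auto simp: polynomial_function_iff_Basis_inner Basis_vec_def inner_axis)

lemma polynomial_function_vec4:
  assumes "real_polynomial_function a" "real_polynomial_function b"
    "real_polynomial_function c" "real_polynomial_function d"
  shows "polynomial_function (\<lambda>x. vec4 (a x) (b x) (c x) (d x))"
proof (rule polynomial_function_vec)
  have "\<forall>i. real_polynomial_function (\<lambda>x. vec4 (a x) (b x) (c x) (d x) $ i)"
    unfolding forall_4_from_0 by (simp add: assms)
  then show "real_polynomial_function (\<lambda>x. vec4 (a x) (b x) (c x) (d x) $ i)" for i by simp
qed

lemma real_polynomial_function_coordinate:
  fixes f :: "'a::real_normed_vector \<Rightarrow> real^'n"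
  assumes "bounded_linear f"
  shows "real_polynomial_function (\<lambda>p. f p $ i)"
  using bounded_linear_compose[OF bounded_linear_vec_nth assms]
  by (rule real_polynomial_function.intros(1))

lemmas polynomial_intros =
  real_polynomial_function.intros(2,3,4) real_polynomial_function_minus
  real_polynomial_function_diff real_polynomial_function_sum

section \<open>The inverse of the morphism on the blow-up\<close>

lemma sum_4_from_0: "sum f (UNIV :: 4 set) = f 0 + f 1 + f 2 + f 3"
proof -
  have "(4::4) = 0" by simp
  then have "f 4 = f 0" by (rule arg_cong)
  then show ?thesis unfolding sum_4 by (simp only: ac_simps)
qed

lemma Delta_eq: "Delta x = (x$0)\<^sup>2 + (x$1)\<^sup>2 + (x$2)\<^sup>2 + (x$3)\<^sup>2"
  by (simp add: Delta_def sum_4_from_0)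

lemma Delta_eq_0_iff [simp]: "Delta x = 0 \<longleftrightarrow> x = 0"
  by (auto simp: Delta_def sum_nonneg_eq_0_iff vec_eq_iff)

text \<open>The bilinear formula for the second factor of the inverse of \<open>sigma\<close>.  In quaternion terms
  it consists of the scalar part of \<open>x\<close> times the conjugate of \<open>w\<close> and twice the vector part of \<open>y\<close>
  times the conjugate of \<open>w\<close>.\<close>

definition inverse_coords :: "real^4 \<Rightarrow> real^4 \<Rightarrow> real^4 \<Rightarrow> real^4" where
  "inverse_coords w x y =
     (let t = trans_vec w y in vec4 (\<Sum>i\<in>UNIV. w$i * x$i) (t$1) (t$2) (t$3))"

lemma inverse_coords_sigma:
  "inverse_coords w (sigma_x w z) (sigma_y w z) = Delta w *\<^sub>R z"
  by (simp add: inverse_coords_def trans_vec_def sigma_x_def sigma_y_def Let_def vec_eq_iff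
      forall_4_from_0 sum_4_from_0 Delta_eq power2_eq_square algebra_simps)

text \<open>In the other direction the equations of the blow-up enter: the first component uses that \<open>x\<close> is
  proportional to \<open>w\<close>, the second that \<open>y\<close> is orthogonal to \<open>w\<close>.\<close>

lemma sigma_inverse_coords:
  assumes yw: "(\<Sum>i\<in>UNIV. y$i * w$i) = 0" and xw: "\<forall>i j. x$i * w$j - x$j * w$i = 0"
  shows "sigma_x w (inverse_coords w x y) = Delta w *\<^sub>R x"
    and "sigma_y w (inverse_coords w x y) = Delta w *\<^sub>R y"
proof -
  have minors: "x$i * w$j = x$j * w$i" for i j using xw by simp
  have "w$i * (\<Sum>j\<in>UNIV. w$j * x$j) = Delta w * x$i" for i
  proof -
    have "w$i * (\<Sum>j\<in>UNIV. w$j * x$j) = (\<Sum>j\<in>UNIV. w$j * (x$j * w$i))"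
      by (simp add: sum_distrib_left ac_simps)
    also have "\<dots> = (\<Sum>j\<in>UNIV. w$j * (x$i * w$j))" by (simp only: minors)
    finally show ?thesis by (simp add: Delta_def sum_distrib_left power2_eq_square ac_simps)
  qed
  then show "sigma_x w (inverse_coords w x y) = Delta w *\<^sub>R x"
    by (simp add: sigma_x_def inverse_coords_def Let_def vec_eq_iff forall_4_from_0)
  have "y$0 * w$0 + y$1 * w$1 + y$2 * w$2 + y$3 * w$3 = 0"
    using yw by (simp add: sum_4_from_0)
  then show "sigma_y w (inverse_coords w x y) = Delta w *\<^sub>R y"
    unfolding vec_eq_iff forall_4_from_0
    apply (simp add: sigma_y_def inverse_coords_def trans_vec_def Let_def Delta_eq)
    apply (intro conjI)
    apply ((insert \<open>y$0 * w$0 + y$1 * w$1 + y$2 * w$2 + y$3 * w$3 = 0\<close>, algebra)[1])+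
    done
qed

text \<open>The equations of the blow-up are bihomogeneous, hence may be tested on any representatives.\<close>

lemma blowup_proj_of_iff:
  assumes "(x, y) \<noteq> 0" "w \<noteq> 0"
  shows "(proj_of (x, y), proj_of w) \<in> blowup \<longleftrightarrow>
    (\<Sum>i\<in>UNIV. x$i * y$i) = 0 \<and> (\<Sum>i\<in>UNIV. y$i * w$i) = 0 \<and> (\<forall>i j. x$i * w$j - x$j * w$i = 0)"
    (is "?L \<longleftrightarrow> ?E x y w")
proof
  assume ?L
  then obtain x' y' w' where *: "(x', y') \<noteq> 0" "w' \<noteq> 0" "?E x' y' w'"
      "proj_of (x, y) = proj_of (x', y')" "proj_of w = proj_of w'"
    unfolding blowup_def by blast
  then obtain c d where cd: "(x, y) = c *\<^sub>R (x', y')" "w = d *\<^sub>R w'"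
    using assms by (metis proj_of_eq_iff)
  have "(\<Sum>i\<in>UNIV. x$i * y$i) = c * c * (\<Sum>i\<in>UNIV. x'$i * y'$i)"
    "(\<Sum>i\<in>UNIV. y$i * w$i) = c * d * (\<Sum>i\<in>UNIV. y'$i * w'$i)"
    "x$i * w$j - x$j * w$i = c * d * (x'$i * w'$j - x'$j * w'$i)" for i j
    using cd by (simp_all add: sum_distrib_left algebra_simps)
  then show "?E x y w" using * by simp
next
  assume "?E x y w"
  then show ?L using assms unfolding blowup_def by blast
qed

lemma sigma_map_in_blowup: "sigma_map p \<in> blowup"
proof -
  obtain w z where p: "w \<noteq> 0" "z \<noteq> 0" "p = (proj_of w, proj_of z)"
    by (metis proj_of_cases surj_pair)
  have "(\<Sum>i\<in>UNIV. sigma_x w z$i * sigma_y w z$i) = 0"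
    "(\<Sum>i\<in>UNIV. sigma_y w z$i * w$i) = 0"
    by (simp_all add: sum_4_from_0 sigma_x_def sigma_y_def Let_def field_simps)
  moreover have "sigma_x w z = (z$0) *\<^sub>R w"
    by (simp add: sigma_x_def Let_def vec_eq_iff forall_4_from_0)
  ultimately show ?thesis
    using p sigma_nonzero[OF p(1,2)] by (simp add: sigma_map_proj_of blowup_proj_of_iff)
qed

lemma sigma_map_inverse_coords:
  assumes nz: "(x, y) \<noteq> 0" "w \<noteq> 0" and "(proj_of (x, y), proj_of w) \<in> blowup"
  shows "inverse_coords w x y \<noteq> 0"
    and "sigma_map (proj_of w, proj_of (inverse_coords w x y)) = (proj_of (x, y), proj_of w)"
proof -
  let ?z = "inverse_coords w x y"
  have "(\<Sum>i\<in>UNIV. y$i * w$i) = 0" "\<forall>i j. x$i * w$j - x$j * w$i = 0"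
    using assms by (simp_all add: blowup_proj_of_iff)
  then have sigma: "(sigma_x w ?z, sigma_y w ?z) = Delta w *\<^sub>R (x, y)"
    by (simp add: sigma_inverse_coords)
  have Delta: "Delta w \<noteq> 0" using nz by simp
  show z: "?z \<noteq> 0"
  proof
    assume "?z = 0"
    then have "Delta w *\<^sub>R (x, y) = 0"
      unfolding sigma[symmetric]
      by (simp add: sigma_x_def sigma_y_def zero_prod_def vec_eq_iff forall_4_from_0)
    then show False using Delta nz(1) by (metis scaleR_eq_0_iff)
  qed
  have "proj_of (sigma_x w ?z, sigma_y w ?z) = proj_of (x, y)"
    unfolding sigma using Delta nz(1) by (rule proj_of_scaleR)
  then show "sigma_map (proj_of w, proj_of ?z) = (proj_of (x, y), proj_of w)"
    using nz(2) z by (simp add: sigma_map_proj_of)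
qed

lemma inj_sigma_map: "inj sigma_map"
proof (rule injI)
  fix p q assume eq: "sigma_map p = sigma_map q"
  obtain w z where p: "w \<noteq> 0" "z \<noteq> 0" "p = (proj_of w, proj_of z)"
    by (metis proj_of_cases surj_pair)
  obtain v z' where q: "v \<noteq> 0" "z' \<noteq> 0" "q = (proj_of v, proj_of z')"
    by (metis proj_of_cases surj_pair)
  have v: "proj_of v = proj_of w" using eq p q by (simp add: sigma_map_proj_of)
  then have "q = (proj_of w, proj_of z')" using q by simp
  then have "proj_of (sigma_x w z, sigma_y w z) = proj_of (sigma_x w z', sigma_y w z')"
    using eq p q by (simp add: sigma_map_proj_of)
  then obtain c where c: "c \<noteq> 0" "(sigma_x w z, sigma_y w z) = c *\<^sub>R (sigma_x w z', sigma_y w z')"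
    using proj_of_eq_iff[OF sigma_nonzero[OF p(1,2)] sigma_nonzero[OF p(1) q(2)]] by blast
  then have "sigma_x w z = sigma_x w (c *\<^sub>R z')" "sigma_y w z = sigma_y w (c *\<^sub>R z')"
    using sigma_scaleR[of 1 w c z'] by simp_all
  then have "Delta w *\<^sub>R z = Delta w *\<^sub>R (c *\<^sub>R z')"
    by (metis inverse_coords_sigma)
  then have "z = c *\<^sub>R z'" using p(1) by (simp only: scaleR_cancel_left Delta_eq_0_iff) simp
  then have "proj_of z = proj_of z'" using q(2) c(1) by (simp add: proj_of_scaleR)
  then show "p = q" using p(3) \<open>q = (proj_of w, proj_of z')\<close> by simp
qed

lemma bij_betw_sigma_map: "bij_betw sigma_map UNIV blowup"
proof -
  have "b \<in> range sigma_map" if b_in: "b \<in> blowup" for b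
  proof -
    obtain x y w where b: "b = (proj_of (x, y), proj_of w)" "(x, y) \<noteq> 0" "w \<noteq> 0"
      using b_in unfolding blowup_def by blast
    with b_in have "b = sigma_map (proj_of w, proj_of (inverse_coords w x y))"
      using sigma_map_inverse_coords(2) by metis
    then show ?thesis by (rule image_eqI) simp
  qed
  then show ?thesis
    using inj_sigma_map sigma_map_in_blowup by (auto simp: bij_betw_def)
qed

section \<open>Biregularity\<close>

lemma regular_map_sigma: "regular_map UNIV blowup sigma_map"
proof (rule regular_map_polynomial)
  note coords = real_polynomial_function_coordinate[OF bounded_linear_fst]
    real_polynomial_function_coordinate[OF bounded_linear_snd]
  have "polynomial_function (\<lambda>p. sigma_x (fst p) (snd p))"
    unfolding sigma_x_def Let_def
    by (intro polynomial_function_vec4 polynomial_intros coords)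
  moreover have "polynomial_function (\<lambda>p. sigma_y (fst p) (snd p))"
    unfolding sigma_y_def Let_def
    by (intro polynomial_function_cmul polynomial_function_vec4 polynomial_intros coords)
  ultimately show "polynomial_function (\<lambda>p. (sigma_x (fst p) (snd p), sigma_y (fst p) (snd p)))"
    by (rule polynomial_function_Pair)
  show "polynomial_function (fst :: (real^4) \<times> (real^4) \<Rightarrow> real^4)"
    by (intro polynomial_function_bounded_linear bounded_linear_fst)
qed (use sigma_map_in_blowup sigma_nonzero in \<open>auto simp: sigma_map_proj_of\<close>)

lemma regular_map_sigma_inverse: "regular_map blowup UNIV (inv_into UNIV sigma_map)"
proof (rule regular_map_polynomial)
  note coords = real_polynomial_function_coordinate[OF bounded_linear_snd]
    real_polynomial_function_coordinate[OF bounded_linear_compose[OF bounded_linear_fst bounded_linear_fst]]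
    real_polynomial_function_coordinate[OF bounded_linear_compose[OF bounded_linear_snd bounded_linear_fst]]
  show "polynomial_function (snd :: ((real^4) \<times> (real^4)) \<times> (real^4) \<Rightarrow> real^4)"
    by (intro polynomial_function_bounded_linear bounded_linear_snd)
  show "polynomial_function (\<lambda>p. inverse_coords (snd p) (fst (fst p)) (snd (fst p)))"
    unfolding inverse_coords_def Let_def trans_vec_def vector_scaleR_component vector_3 real_scaleR_def
    by (intro polynomial_function_vec4 polynomial_intros coords finite)
next
  fix u :: "(real^4) \<times> (real^4)" and w :: "real^4"
  assume "u \<noteq> 0" "w \<noteq> 0" "(proj_of u, proj_of w) \<in> blowup"
  moreover obtain x y where "u = (x, y)" by (cases u)
  ultimately have *: "inverse_coords w x y \<noteq> 0"
    "sigma_map (proj_of w, proj_of (inverse_coords w x y)) = (proj_of u, proj_of w)" "w \<noteq> 0"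
    using sigma_map_inverse_coords[of x y w] by auto
  with \<open>u = (x, y)\<close> show "snd (u, w) \<noteq> 0 \<and> inverse_coords (snd (u, w)) (fst (fst (u, w))) (snd (fst (u, w))) \<noteq> 0"
    by simp
  have "inv_into UNIV sigma_map (proj_of u, proj_of w) = (proj_of w, proj_of (inverse_coords w x y))"
    using inj_sigma_map *(2) by (rule inv_f_eq)
  with \<open>u = (x, y)\<close> show "inv_into UNIV sigma_map (proj_of u, proj_of w) =
      (proj_of (snd (u, w)), proj_of (inverse_coords (snd (u, w)) (fst (fst (u, w))) (snd (fst (u, w)))))"
    by simp
qed simp

lemma biregular_iso_sigma_map: "biregular_iso UNIV blowup sigma_map"
  unfolding biregular_iso_def
  using bij_betw_sigma_map regular_map_sigma regular_map_sigma_inverse by blast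

section \<open>Rotations and quaternions up to scale\<close>

text \<open>For a unit quaternion \<open>w\<close> this is the matrix with entries \<open>4 w\<^sub>i w\<^sub>j\<close>, written as affine-linear
  functions of the entries of the rotation matrix of \<open>w\<close>.  So the rotation determines all products
  of the coordinates of \<open>w\<close>, that is, the point \<open>[w]\<close>.\<close>

definition quat_products :: "real^3^3 \<Rightarrow> real^4^4" where
  "quat_products R = (\<chi> i.
     if i = 0 then vec4 (1 + R$1$1 + R$2$2 + R$3$3) (R$3$2 - R$2$3) (R$1$3 - R$3$1) (R$2$1 - R$1$2)
     else if i = 1 then vec4 (R$3$2 - R$2$3) (1 + R$1$1 - R$2$2 - R$3$3) (R$1$2 + R$2$1) (R$1$3 + R$3$1)
     else if i = 2 then vec4 (R$1$3 - R$3$1) (R$1$2 + R$2$1) (1 - R$1$1 + R$2$2 - R$3$3) (R$2$3 + R$3$2)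
     else vec4 (R$2$1 - R$1$2) (R$1$3 + R$3$1) (R$2$3 + R$3$2) (1 - R$1$1 - R$2$2 + R$3$3))"

text \<open>The constant \<open>1\<close> in the diagonal entries is what makes this work without normalising \<open>w\<close>:
  it equals \<open>Delta w / Delta w\<close>.\<close>

lemma quat_products_rot_mat:
  assumes "w \<noteq> 0"
  shows "quat_products ((1 / Delta w) *\<^sub>R rot_mat w) $ i $ j = 4 * w$i * w$j / Delta w"
proof -
  define d where "d = 1 / Delta w"
  have d: "d * ((w$0)\<^sup>2 + (w$1)\<^sup>2 + (w$2)\<^sup>2 + (w$3)\<^sup>2) = 1"
    using assms Delta_eq_0_iff[of w] by (simp add: d_def flip: Delta_eq)
  have "\<forall>i j. quat_products (d *\<^sub>R rot_mat w) $ i $ j = d * (4 * w$i * w$j)"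
    unfolding forall_4_from_0 quat_products_def rot_mat_def
    apply simp
    apply (intro conjI)
    apply ((insert d, algebra)[1] | (simp add: algebra_simps)[1])+
    done
  then show ?thesis by (simp add: d_def)
qed

lemma rotation_matrix_row_inner:
  fixes R :: "real^3^3"
  assumes "rotation_matrix R"
  shows "R$i$1 * R$j$1 + R$i$2 * R$j$2 + R$i$3 * R$j$3 = (if i = j then 1 else 0)"
proof -
  have "(R ** transpose R)$i$j = (mat 1 :: real^3^3)$i$j"
    using assms by (simp add: rotation_matrix_def orthogonal_matrix_def)
  then show ?thesis by (simp add: matrix_matrix_mult_def transpose_def mat_def sum_3)
qed

lemma rotation_matrix_column_inner:
  fixes R :: "real^3^3"
  assumes "rotation_matrix R"
  shows "R$1$i * R$1$j + R$2$i * R$2$j + R$3$i * R$3$j = (if i = j then 1 else 0)"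
proof -
  have "rotation_matrix (transpose R)"
    using assms by (simp add: rotation_matrix_def)
  from rotation_matrix_row_inner[OF this, of i j] show ?thesis by (simp add: transpose_def)
qed

text \<open>A rotation preserves cross products, so its columns are the cross products of one another.\<close>

lemma rotation_matrix_cofactors:
  fixes R :: "real^3^3"
  assumes "rotation_matrix R"
  shows "R$2$2 * R$3$3 - R$3$2 * R$2$3 = R$1$1"
    and "R$2$3 * R$3$1 - R$3$3 * R$2$1 = R$1$2"
    and "R$2$1 * R$3$2 - R$3$1 * R$2$2 = R$1$3"
    and "R$3$2 * R$1$3 - R$1$2 * R$3$3 = R$2$1"
    and "R$3$3 * R$1$1 - R$1$3 * R$3$1 = R$2$2"
    and "R$3$1 * R$1$2 - R$1$1 * R$3$2 = R$2$3"
    and "R$1$2 * R$2$3 - R$2$2 * R$1$3 = R$3$1"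
    and "R$1$3 * R$2$1 - R$2$3 * R$1$1 = R$3$2"
    and "R$1$1 * R$2$2 - R$2$1 * R$1$2 = R$3$3"
proof -
  have "cross3 (R *v x) (R *v y) = R *v cross3 x y" for x y
    using assms by (rule cross_rotation_matrix)
  note this[of "axis 2 1" "axis 3 1"] this[of "axis 3 1" "axis 1 1"] this[of "axis 1 1" "axis 2 1"]
  note columns = this[unfolded cross_basis matrix_vector_mult_basis]
  have "cross3 (column 2 R) (column 3 R) $ k = R$k$1"
    "cross3 (column 3 R) (column 1 R) $ k = R$k$2"
    "cross3 (column 1 R) (column 2 R) $ k = R$k$3" for k
    by (simp_all only: columns) (simp_all add: column_def)
  note this[of 1] this[of 2] this[of 3]
  note cross = this[unfolded cross3_def column_def, simplified]
  show "R$2$2 * R$3$3 - R$3$2 * R$2$3 = R$1$1"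
    and "R$2$3 * R$3$1 - R$3$3 * R$2$1 = R$1$2"
    and "R$2$1 * R$3$2 - R$3$1 * R$2$2 = R$1$3"
    and "R$3$2 * R$1$3 - R$1$2 * R$3$3 = R$2$1"
    and "R$3$3 * R$1$1 - R$1$3 * R$3$1 = R$2$2"
    and "R$3$1 * R$1$2 - R$1$1 * R$3$2 = R$2$3"
    and "R$1$2 * R$2$3 - R$2$2 * R$1$3 = R$3$1"
    and "R$1$3 * R$2$1 - R$2$3 * R$1$1 = R$3$2"
    and "R$1$1 * R$2$2 - R$2$1 * R$1$2 = R$3$3"
    by (fact cross)+
qed

text \<open>A symmetric matrix of rank one factors as \<open>w\<^sub>i w\<^sub>j\<close> up to scale, so this is the point where a quaternion
  is recovered from a rotation.  Each minor is a linear combination of four relations: two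
  Gram relations and two cofactor relations for off-diagonal positions, three Gram relations
  and one cofactor relation for diagonal ones.  Complementary principal minors, such as those on the
  index pairs \<open>0, 1\<close> and \<open>2, 3\<close>, come from the same four relations.\<close>

lemma quat_products_rank_one:
  assumes "rotation_matrix R"
  shows "quat_products R $ c $ i * quat_products R $ c $ j = quat_products R $ c $ c * quat_products R $ i $ j"
proof -
  \<comment> \<open>Names for the entries keep the terms small for the Groebner basis computations below.\<close>
  define a where "a = R$1$1"
  define b where "b = R$1$2"
  define c' where "c' = R$1$3"
  define d where "d = R$2$1"
  define e where "e = R$2$2"
  define f where "f = R$2$3"
  define g where "g = R$3$1"
  define h where "h = R$3$2"
  define k where "k = R$3$3"
  note entries = a_def[symmetric] b_def[symmetric] c'_def[symmetric] d_def[symmetric] e_def[symmetric] f_def[symmetric] g_def[symmetric] h_def[symmetric] k_def[symmetric]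
  note row = rotation_matrix_row_inner[OF assms]
  note col = rotation_matrix_column_inner[OF assms]
  note cof = rotation_matrix_cofactors[OF assms, unfolded entries]
  note gram = row[of 1 1, unfolded entries]
    col[of 2 2, unfolded entries]
    col[of 3 3, unfolded entries]
    row[of 3 3, unfolded entries]
    row[of 2 2, unfolded entries]
    row[of 1 2, unfolded entries]
    col[of 1 2, unfolded entries]
    row[of 1 3, unfolded entries]
    col[of 1 3, unfolded entries]
    row[of 2 3, unfolded entries]
    col[of 2 3, unfolded entries]
  have diag1: "a * a + b * b + c' * c' = 1" "b * b + e * e + h * h = 1" "c' * c' + f * f + k * k = 1"
    and diag2: "g * g + h * h + k * k = 1"
    and diag3: "d * d + e * e + f * f = 1"
    and off12: "a * d + b * e + c' * f = 0" "a * b + d * e + g * h = 0"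
    and off13: "a * g + b * h + c' * k = 0" "a * c' + d * f + g * k = 0"
    and off23: "d * g + e * h + f * k = 0" "b * c' + e * f + h * k = 0"
    by (simp_all add: gram)
  let ?K = "quat_products R"
  have K: "?K$0$0 = 1 + a + e + k" "?K$0$1 = h - f" "?K$0$2 = c' - g" "?K$0$3 = d - b"
    "?K$1$0 = h - f" "?K$1$1 = 1 + a - e - k" "?K$1$2 = b + d" "?K$1$3 = c' + g"
    "?K$2$0 = c' - g" "?K$2$1 = b + d" "?K$2$2 = 1 - a + e - k" "?K$2$3 = f + h"
    "?K$3$0 = d - b" "?K$3$1 = c' + g" "?K$3$2 = f + h" "?K$3$3 = 1 - a - e + k"
    by (simp_all add: quat_products_def entries)
  have minor1: "?K$0$1 * ?K$0$1 = ?K$0$0 * ?K$1$1"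
    "?K$2$3 * ?K$2$3 = ?K$2$2 * ?K$3$3"
    unfolding K using diag1 cof(1) by algebra+
  have minor2: "?K$0$2 * ?K$0$2 = ?K$0$0 * ?K$2$2"
    "?K$1$3 * ?K$1$3 = ?K$1$1 * ?K$3$3"
    unfolding K using diag1(1,2) diag2 cof(5) by algebra+
  have minor3: "?K$0$3 * ?K$0$3 = ?K$0$0 * ?K$3$3"
    "?K$1$2 * ?K$1$2 = ?K$1$1 * ?K$2$2"
    unfolding K using diag1(1,3) diag3 cof(9) by algebra+
  have minor4: "?K$0$1 * ?K$0$2 = ?K$0$0 * ?K$1$2"
    "?K$1$0 * ?K$1$3 = ?K$1$1 * ?K$0$3"
    "?K$2$0 * ?K$2$3 = ?K$2$2 * ?K$0$3"
    "?K$3$1 * ?K$3$2 = ?K$3$3 * ?K$1$2"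
    unfolding K using off12 cof(2,4) by algebra+
  have minor5: "?K$0$1 * ?K$0$3 = ?K$0$0 * ?K$1$3"
    "?K$1$0 * ?K$1$2 = ?K$1$1 * ?K$0$2"
    "?K$2$1 * ?K$2$3 = ?K$2$2 * ?K$1$3"
    "?K$3$0 * ?K$3$2 = ?K$3$3 * ?K$0$2"
    unfolding K using off13 cof(3,7) by algebra+
  have minor6: "?K$0$2 * ?K$0$3 = ?K$0$0 * ?K$2$3"
    "?K$1$2 * ?K$1$3 = ?K$1$1 * ?K$2$3"
    "?K$2$0 * ?K$2$1 = ?K$2$2 * ?K$0$1"
    "?K$3$0 * ?K$3$1 = ?K$3$3 * ?K$0$1"
    unfolding K using off23 cof(6,8) by algebra+
  have symmetric: "?K$1$0 = ?K$0$1" "?K$2$0 = ?K$0$2" "?K$3$0 = ?K$0$3"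
    "?K$2$1 = ?K$1$2" "?K$3$1 = ?K$1$3" "?K$3$2 = ?K$2$3"
    unfolding K by (simp_all add: add.commute)
  have "\<forall>c i j. ?K$c$i * ?K$c$j = ?K$c$c * ?K$i$j"
    unfolding forall_4_from_0 symmetric
    using minor1 minor2 minor3 minor4 minor5 minor6 unfolding symmetric
    by (simp add: mult.commute)
  then show ?thesis by simp
qed

text \<open>Every rotation comes from a quaternion.  The trace of the rank-one matrix is \<open>4\<close>, so some diagonal
  entry is nonzero, and the row through that entry is the quaternion up to scale.  The row has to
  depend on \<open>R\<close>: each row vanishes for some rotation, namely where that coordinate of \<open>w\<close> is zero.\<close>

lemma rotation_matrix_eq_rot_mat:
  fixes R :: "real^3^3"
  assumes "rotation_matrix R"
  obtains w where "w \<noteq> 0" "R = (1 / Delta w) *\<^sub>R rot_mat w"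
proof -
  let ?K = "quat_products R"
  have trace: "?K$0$0 + ?K$1$1 + ?K$2$2 + ?K$3$3 = 4"
    by (simp add: quat_products_def)
  then obtain c where c: "?K$c$c \<noteq> 0" by (metis add_0 zero_neq_numeral)
  define w where "w = ?K$c"
  have ww: "w$i * w$j = ?K$c$c * ?K$i$j" for i j
    unfolding w_def by (rule quat_products_rank_one[OF assms])
  have "w \<noteq> 0" using c by (auto simp: w_def vec_eq_iff)
  have "Delta w = ?K$c$c * (?K$0$0 + ?K$1$1 + ?K$2$2 + ?K$3$3)"
    by (simp add: Delta_eq power2_eq_square ww distrib_left)
  then have Delta: "Delta w = 4 * ?K$c$c" using trace by simp
  have "rot_mat w = (4 * ?K$c$c) *\<^sub>R R"
    unfolding rot_mat_def vec_eq_iff forall_3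
    by (simp add: power2_eq_square ww) (simp add: quat_products_def algebra_simps)
  then have "R = (1 / Delta w) *\<^sub>R rot_mat w"
    using c by (simp add: Delta)
  with \<open>w \<noteq> 0\<close> show thesis by (rule that)
qed

text \<open>Equal rotations give equal products of coordinates, up to the norms, and these determine the ratios.\<close>

lemma proj_rotation_eqD:
  assumes "proj_rotation p = proj_rotation q"
  shows "p = q"
proof -
  obtain v w where pq: "v \<noteq> 0" "p = proj_of v" "w \<noteq> 0" "q = proj_of w"
    by (metis proj_of_cases)
  then have "quat_products ((1 / Delta v) *\<^sub>R rot_mat v) = quat_products ((1 / Delta w) *\<^sub>R rot_mat w)"
    using assms by (simp add: proj_rotation_proj_of)
  then have products: "v$i * v$j / Delta v = w$i * w$j / Delta w" for i j
    using quat_products_rot_mat[OF pq(1), of i j] quat_products_rot_mat[OF pq(3), of i j] by simp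
  have Delta: "Delta v \<noteq> 0" "Delta w \<noteq> 0" using pq by simp_all
  obtain i where i: "v$i \<noteq> 0" using pq(1) by (auto simp: vec_eq_iff)
  with products[of i i] Delta have wi: "w$i \<noteq> 0" by auto
  define c where "c = Delta v * w$i / (Delta w * v$i)"
  have "v$j = c * w$j" for j
    using products[of i j] i Delta by (simp add: c_def field_simps)
  then have "v = c *\<^sub>R w" by (simp add: vec_eq_iff)
  moreover have "c \<noteq> 0" using i wi Delta by (simp add: c_def)
  ultimately show "p = q" using pq by (auto simp: proj_of_eq_iff)
qed

section \<open>Rigid motions in the two compactifications\<close>

lemma rigid_motion_eq_iff: "rigid_motion R t = rigid_motion R' t' \<longleftrightarrow> R = R' \<and> t = t'"
proof
  assume eq: "rigid_motion R t = rigid_motion R' t'"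
  from fun_cong[OF eq, of 0] have "t = t'" by (simp add: rigid_motion_def)
  moreover have "R *v v = R' *v v" for v
    using fun_cong[OF eq, of v] \<open>t = t'\<close> by (simp add: rigid_motion_def)
  ultimately show "R = R' \<and> t = t'" by (simp add: matrix_eq)
qed simp

lemma beta_rigid_motion:
  assumes "w \<noteq> 0" and "proj_rotation (proj_of w) \<in> SO3"
  shows "beta (rigid_motion (proj_rotation (proj_of w)) t) = (proj_of w, embed_R3 t)"
proof -
  have "inj_on (\<lambda>(R, t). rigid_motion R t) (SO3 \<times> UNIV)"
    by (auto simp: inj_on_def rigid_motion_eq_iff)
  then have "inv_into (SO3 \<times> UNIV) (\<lambda>(R, t). rigid_motion R t)
      (rigid_motion (proj_rotation (proj_of w)) t) = (proj_rotation (proj_of w), t)"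
    by (rule inv_into_f_eq) (use assms in auto)
  moreover have "inv_into UNIV proj_rotation (proj_rotation (proj_of w)) = proj_of w"
    by (intro inv_f_f injI proj_rotation_eqD)
  ultimately show ?thesis by (simp add: beta_def)
qed

lemma trans_vec_sigma_y: "trans_vec w (sigma_y w (vec4 r (t$1) (t$2) (t$3))) = Delta w *\<^sub>R t"
  by (simp add: trans_vec_def sigma_y_def Let_def vec_eq_iff forall_3 Delta_eq power2_eq_square algebra_simps)

lemma sigma_x_affine: "sigma_x w (vec4 1 a b c) = w"
  by (simp add: sigma_x_def vec_eq_iff forall_4_from_0)

text \<open>For \<open>r = 1\<close> the first component of \<open>sigma\<close> is \<open>[w, y]\<close> with \<open>trans_vec w y = Delta w *\<^sub>R t\<close>, and the
  factor cancels against the denominator of the Study correspondence.  This is the compatibility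
  of the two compactifications.\<close>

lemma study_motion_sigma:
  assumes "w \<noteq> 0"
  shows "study_motion (fst (sigma_map (proj_of w, embed_R3 t))) = rigid_motion (proj_rotation (proj_of w)) t"
proof -
  let ?z = "vec4 1 (t$1) (t$2) (t$3)"
  have "?z \<noteq> 0" by (simp add: vec_eq_iff forall_4_from_0)
  then have "fst (sigma_map (proj_of w, embed_R3 t)) = proj_of (w, sigma_y w ?z)" "(w, sigma_y w ?z) \<noteq> 0"
    using assms by (simp_all add: embed_R3_def sigma_map_proj_of sigma_x_affine zero_prod_def)
  then show ?thesis
    using assms
    by (simp add: fun_eq_iff study_motion_proj_of trans_vec_sigma_y rigid_motion_def
        proj_rotation_proj_of scaleR_add_right scaleR_matrix_vector_assoc)
qed

lemma proj_of_in_exc_plane_iff: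
  assumes "(x, y) \<noteq> 0"
  shows "proj_of (x, y) \<in> exc_plane \<longleftrightarrow> x = 0"
proof
  assume "proj_of (x, y) \<in> exc_plane"
  then obtain y' where "y' \<noteq> 0" "proj_of (x, y) = proj_of (0, y')"
    unfolding exc_plane_def by blast
  then obtain c where "(x, y) = c *\<^sub>R (0, y')"
    using assms proj_of_eq_iff[of "(x, y)" "(0, y')"] by (auto simp: zero_prod_def)
  then show "x = 0" by simp
next
  assume "x = 0"
  then show "proj_of (x, y) \<in> exc_plane" using assms by (auto simp: exc_plane_def zero_prod_def)
qed

lemma fst_sigma_map_affine: "fst (sigma_map (p, embed_R3 t)) \<in> study_quadric - exc_plane"
proof -
  obtain w where w: "w \<noteq> 0" "p = proj_of w" by (rule proj_of_cases)
  let ?z = "vec4 1 (t$1) (t$2) (t$3)"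
  have "?z \<noteq> 0" by (simp add: vec_eq_iff forall_4_from_0)
  then have eq: "sigma_map (p, embed_R3 t) = (proj_of (w, sigma_y w ?z), proj_of w)"
    using w by (simp add: embed_R3_def sigma_map_proj_of sigma_x_affine)
  have nz: "(w, sigma_y w ?z) \<noteq> 0" using w by (simp add: zero_prod_def)
  have "(\<Sum>i\<in>UNIV. w$i * sigma_y w ?z$i) = 0"
    using sigma_map_in_blowup[of "(p, embed_R3 t)"] unfolding eq
    by (simp add: blowup_proj_of_iff[OF nz w(1)])
  then have "proj_of (w, sigma_y w ?z) \<in> study_quadric"
    using nz unfolding study_quadric_def by blast
  then show ?thesis using w(1) nz by (simp add: eq proj_of_in_exc_plane_iff)
qed

text \<open>Away from the exceptional plane \<open>x\<close> is nonzero, and its proportionality to \<open>w\<close> fixes the second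
  factor.  This makes the projection of the blow-up injective there.\<close>

lemma blowup_off_exc_plane:
  assumes "b \<in> blowup" "fst b \<notin> exc_plane"
  obtains x y where "x \<noteq> 0" "b = (proj_of (x, y), proj_of x)"
proof -
  obtain x y w where b: "b = (proj_of (x, y), proj_of w)" "(x, y) \<noteq> 0" "w \<noteq> 0"
      "\<forall>i j. x$i * w$j - x$j * w$i = 0"
    using assms(1) unfolding blowup_def by blast
  have x: "x \<noteq> 0" using assms(2) b by (auto simp: proj_of_in_exc_plane_iff)
  obtain j where j: "w$j \<noteq> 0" using b(3) by (auto simp: vec_eq_iff)
  define c where "c = x$j / w$j"
  have "x$i = c * w$i" for i
    using b(4)[rule_format, of i j] j by (simp add: c_def field_simps)
  then have xw: "x = c *\<^sub>R w" by (simp add: vec_eq_iff)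
  with x have "c \<noteq> 0" by (metis scaleR_zero_left)
  then have "proj_of w = proj_of x" unfolding xw using b(3) by (simp add: proj_of_scaleR)
  then show thesis using that[OF x] b(1) by simp
qed

lemma inj_on_fst_blowup: "inj_on fst (blowup - fst -` exc_plane)"
proof (rule inj_onI)
  fix b b' assume in_dom: "b \<in> blowup - fst -` exc_plane" "b' \<in> blowup - fst -` exc_plane"
    and eq: "fst b = fst b'"
  obtain x y where b: "x \<noteq> 0" "b = (proj_of (x, y), proj_of x)"
    using in_dom(1) by (auto elim: blowup_off_exc_plane)
  obtain x' y' where b': "x' \<noteq> 0" "b' = (proj_of (x', y'), proj_of x')"
    using in_dom(2) by (auto elim: blowup_off_exc_plane)
  obtain c where "c \<noteq> 0" "(x, y) = c *\<^sub>R (x', y')"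
    using b b' eq proj_of_eq_iff[of "(x, y)" "(x', y')"] by (auto simp: zero_prod_def)
  then have "proj_of x = proj_of x'" using b(1) b'(1) by (auto simp: proj_of_eq_iff)
  then show "b = b'" using b b' eq by simp
qed

text \<open>A point of the quadric with \<open>x \<noteq> 0\<close> lifts to the point \<open>([x, y], [x])\<close> of the blow-up, because the
  equation of the quadric becomes the condition that \<open>y\<close> is orthogonal to \<open>w = x\<close>.  Its preimage under \<open>sigma\<close> then
  has a nonzero first coordinate, so it is a pair of a rotation and an affine translation vector.\<close>

lemma study_quadric_off_exc_plane:
  assumes "p \<in> study_quadric - exc_plane"
  obtains w t where "w \<noteq> 0" "p = fst (sigma_map (proj_of w, embed_R3 t))"
proof -
  obtain x y where p: "p = proj_of (x, y)" "(x, y) \<noteq> 0" "(\<Sum>i\<in>UNIV. x$i * y$i) = 0"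
    using assms unfolding study_quadric_def by blast
  have x: "x \<noteq> 0" using assms p by (auto simp: proj_of_in_exc_plane_iff)
  then have Delta: "Delta x \<noteq> 0" by simp
  let ?t = "(1 / Delta x) *\<^sub>R trans_vec x y"
  have "(proj_of (x, y), proj_of x) \<in> blowup"
    using p x by (simp add: blowup_proj_of_iff mult.commute)
  note inv = sigma_map_inverse_coords[OF p(2) x this]
  have coords: "inverse_coords x x y = Delta x *\<^sub>R vec4 1 (?t$1) (?t$2) (?t$3)"
    using Delta by (simp add: inverse_coords_def Let_def vec_eq_iff forall_4_from_0 Delta_def power2_eq_square)
  have "vec4 1 (?t$1) (?t$2) (?t$3) \<noteq> 0" by (simp add: vec_eq_iff forall_4_from_0)
  then have "proj_of (inverse_coords x x y) = embed_R3 ?t"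
    unfolding embed_R3_def coords by (rule proj_of_scaleR[OF Delta])
  then show thesis using that[OF x, of ?t] inv(2) p(1) by simp
qed

text \<open>Injectivity of the Study correspondence is inherited from \<open>sigma\<close>: a point off the exceptional plane
  is the image of a rotation and a translation vector, which can be read off from its motion.\<close>

lemma inj_on_study_motion: "inj_on study_motion (study_quadric - exc_plane)"
proof (rule inj_onI)
  fix p q assume p: "p \<in> study_quadric - exc_plane" and q: "q \<in> study_quadric - exc_plane"
    and eq: "study_motion p = study_motion q"
  obtain w t where w: "w \<noteq> 0" "p = fst (sigma_map (proj_of w, embed_R3 t))"
    using p by (rule study_quadric_off_exc_plane)
  obtain w' t' where w': "w' \<noteq> 0" "q = fst (sigma_map (proj_of w', embed_R3 t'))"
    using q by (rule study_quadric_off_exc_plane)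
  have "rigid_motion (proj_rotation (proj_of w)) t = rigid_motion (proj_rotation (proj_of w')) t'"
    using eq w w' by (simp add: study_motion_sigma)
  then have "proj_of w = proj_of w'" "t = t'"
    by (auto simp: rigid_motion_eq_iff dest: proj_rotation_eqD)
  then show "p = q" using w w' by simp
qed

lemma alpha_eq_sigma_beta:
  assumes "g \<in> SE3"
  shows "alpha g = sigma_map (beta g)"
proof -
  obtain R t where g: "R \<in> SO3" "g = rigid_motion R t" using assms by (auto simp: SE3_def)
  then obtain w where w: "w \<noteq> 0" "R = (1 / Delta w) *\<^sub>R rot_mat w"
    using rotation_matrix_eq_rot_mat[of R] by (auto simp: SO3_def)
  then have R: "R = proj_rotation (proj_of w)" by (simp add: proj_rotation_proj_of)
  let ?b = "sigma_map (proj_of w, embed_R3 t)"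
  have beta: "sigma_map (beta g) = ?b"
    using beta_rigid_motion[OF w(1), of t] g R by simp
  have off: "fst ?b \<in> study_quadric - exc_plane" by (rule fst_sigma_map_affine)
  have "study_motion (fst ?b) = g" using study_motion_sigma[OF w(1)] g(2) R by simp
  with inj_on_study_motion off
  have "inv_into (study_quadric - exc_plane) study_motion g = fst ?b" by (rule inv_into_f_eq)
  moreover have "inv_into (blowup - fst -` exc_plane) fst (fst ?b) = ?b"
    using inj_on_fst_blowup off sigma_map_in_blowup by (intro inv_into_f_eq) auto
  ultimately show ?thesis by (simp add: alpha_def beta)
qed

theorem theorem3:
  "(\<forall>w z. w \<noteq> 0 \<and> z \<noteq> 0 \<longrightarrow>
      (sigma_x w z, sigma_y w z) \<noteq> 0 \<and>
      sigma_map (proj_of w, proj_of z) = (proj_of (sigma_x w z, sigma_y w z), proj_of w)) \<and>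
   biregular_iso UNIV blowup sigma_map \<and>
   (\<forall>g\<in>SE3. alpha g = sigma_map (beta g))"
  using sigma_nonzero sigma_map_proj_of biregular_iso_sigma_map alpha_eq_sigma_beta by blast

end
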